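(* Let $p\ge 1$ be an integer and let $k,n$ be integers with $0\leq k \leq n$. If $h_k(\Gamma_n^p)$ is the number of maximal hypercubes of dimension $k$ in $\Gamma_n^p$, then $$h_k(\Gamma_n^p)=\binom{k+1}{n-(p+1)k+p}_{p}.$$
   Context: For an integer $n\ge 0$, the hypercube $Q_n$ has vertex set $\{0,1\}^n$ (binary strings of length $n$; for $n=0$ only the empty string), two strings being adjacent iff they differ in exactly one coordinate. For $p\ge1$, a Fibonacci $p$-string is a binary string in which any two consecutive 1s (i.e. successive occurrences of 1) are separated by at least $p$ 0s. The Fibonacci $p$-cube $\Gamma_n^p$ is the subgraph of $Q_n$ induced by the Fibonacci $p$-strings of length $n$; in particular $\Gamma_0^p=K_1$. A maximal hypercube of dimension $k$ of a graph $G$ is an induced subgraph $H$ of $G$ isomorphic to $Q_k$ that is not contained in a larger induced subgraph of $G$ isomorphic to a hypercube. For integers $p\ge1$, $b\ge 0$ and $a$, $\binom{b}{a}_{p}$ denotes the coefficient of $x^a$ in $(1+x+x^2+\dots+x^{p})^b$ (so it is $0$ for $a<0$ or $a>bp$). *)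

theory Defs
  imports "Graph_Theory.Graph_Theory" "HOL-Computational_Algebra.Polynomial"
begin

text \<open>Binary strings are lists of booleans, with \<^term>\<open>True\<close> for the letter 1. As usual in this
  graph library, undirected graphs are symmetric digraphs: each edge is a pair of opposite arcs.\<close>

definition hypercube :: "nat \<Rightarrow> (bool list, bool list \<times> bool list) pre_digraph" where
  "hypercube n = with_proj
     \<lparr> pverts = {u. length u = n},
       parcs = {(u, v). length u = n \<and> length v = n \<and> (\<exists>!i. i < n \<and> u ! i \<noteq> v ! i)} \<rparr>"

text \<open>In the following, \<open>i < j\<close> are the positions of two successive 1s, so that the letters between
  them are exactly \<open>j - i - 1\<close> zeros.\<close>

definition fibonacci_string :: "nat \<Rightarrow> bool list \<Rightarrow> bool" where
  "fibonacci_string p w \<longleftrightarrow>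
     (\<forall>i j. i < j \<and> j < length w \<and> w ! i \<and> w ! j \<and> (\<forall>l. i < l \<and> l < j \<longrightarrow> \<not> w ! l)
        \<longrightarrow> p \<le> j - i - 1)"

definition fibonacci_cube :: "nat \<Rightarrow> nat \<Rightarrow> (bool list, bool list \<times> bool list) pre_digraph" where
  "fibonacci_cube p n = hypercube n \<restriction> {w. length w = n \<and> fibonacci_string p w}"

definition maximal_hypercubes :: "('a, 'b) pre_digraph \<Rightarrow> nat \<Rightarrow> ('a, 'b) pre_digraph set" where
  "maximal_hypercubes G k =
     {H. induced_subgraph H G \<and> digraph_iso H (hypercube k) \<and>
         \<not> (\<exists>H' m. induced_subgraph H' G \<and> digraph_iso H' (hypercube m) \<and>
               subgraph H H' \<and> H \<noteq> H')}"

definition num_maximal_hypercubes :: "('a, 'b) pre_digraph \<Rightarrow> nat \<Rightarrow> nat" where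
  "num_maximal_hypercubes G k = card (maximal_hypercubes G k)"

definition pbinomial :: "nat \<Rightarrow> nat \<Rightarrow> int \<Rightarrow> nat" where
  "pbinomial p b a =
     (if a < 0 then 0 else poly.coeff ((\<Sum>i\<le>p. monom 1 i) ^ b) (nat a))"

lemma graph_with_proj:
  assumes "finite V" and "A \<subseteq> V \<times> V" and "sym A" and "irrefl A"
  shows "graph (with_proj \<lparr> pverts = V, parcs = A \<rparr>)"
proof -
  have "finite A"
    using assms(1,2) by (meson finite_SigmaI finite_subset)
  with assms show ?thesis
    by unfold_locales
       (auto simp: symmetric_def arc_to_ends_def irrefl_def)
qed

lemma graph_hypercube: "graph (hypercube n)"
  unfolding hypercube_def
proof (rule graph_with_proj)
  show "finite {u :: bool list. length u = n}"
    using finite_lists_length_eq[of "UNIV :: bool set" n] by simp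
  have "(\<exists>!i. i < n \<and> v ! i \<noteq> u ! i)" if "\<exists>!i. i < n \<and> u ! i \<noteq> v ! i" for u v :: "bool list"
  proof -
    have "v ! i \<noteq> u ! i \<longleftrightarrow> u ! i \<noteq> v ! i" for i
      by (rule neq_commute)
    then show ?thesis
      using that by (simp only:)
  qed
  then show "sym {(u :: bool list, v). length u = n \<and> length v = n \<and> (\<exists>!i. i < n \<and> u ! i \<noteq> v ! i)}"
    unfolding sym_def by blast
qed (auto simp: irrefl_def)

lemma induced_subgraph_fibonacci_cube: "induced_subgraph (fibonacci_cube p n) (hypercube n)"
proof -
  interpret graph "hypercube n" by (rule graph_hypercube)
  show ?thesis
    unfolding fibonacci_cube_def by (rule induced_induce) (auto simp: hypercube_def)
qed

lemma finite_maximal_hypercubes: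
  assumes "fin_digraph G"
  shows "finite (maximal_hypercubes G k)"
proof -
  interpret fin_digraph G by (rule assms)
  have "H = G \<restriction> verts H" if "induced_subgraph H G" for H
  proof (rule pre_digraph.equality)
    show "arcs H = arcs (G \<restriction> verts H)"
      using that unfolding induced_subgraph_def by simp
    show "tail H = tail (G \<restriction> verts H)" "head H = head (G \<restriction> verts H)"
      using that by (simp_all add: induced_subgraph_def subgraph_def compatible_def)
  qed simp_all
  then have "maximal_hypercubes G k \<subseteq> (\<lambda>V. G \<restriction> V) ` Pow (verts G)"
    by (auto simp: maximal_hypercubes_def induced_subgraph_def subgraph_def)
  then show ?thesis
    by (rule finite_subset) simp
qed

end

theory Submission
  imports Defs
begin

text \<open>
  A string is identified with the set \<open>S \<subseteq> {..<n}\<close> of positions of its 1s. It is a Fibonacci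
  \<open>p\<close>-string iff distinct elements of \<open>S\<close> differ by more than \<open>p\<close> (\<open>sparse\<close>), a property that passes
  to subsets. So the strings below a Fibonacci string \<open>t\<close> all lie in the Fibonacci cube, where they
  span a hypercube whose dimension is the number of 1s of \<open>t\<close>.

  Conversely, every hypercube \<open>H\<close> inside \<open>Q\<^sub>n\<close> has a vertex \<open>t\<close> that lies above all the others
  (\<open>cube_has_top\<close>): starting from a vertex with the largest number of 1s, every step away from it
  deletes a 1, because in \<open>Q\<^sub>n\<close> the two neighbours of a vertex on a 4-cycle determine the opposite
  vertex. If \<open>H\<close> lies in the Fibonacci cube, then \<open>t\<close> is a Fibonacci string and \<open>H\<close> is contained in
  the hypercube of the strings below \<open>t\<close>. Hence the maximal hypercubes of dimension \<open>k\<close> correspond to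
  the inclusion-maximal sparse sets with \<open>k\<close> elements (\<open>maximal_hypercubes_fibonacci_cube\<close>).

  A sparse set is maximal iff every position is within distance \<open>p\<close> of one of its elements. Imagine
  one more element at \<open>-(p + 1)\<close> and another one at \<open>n + p\<close>; then the condition says exactly that each of
  the \<open>k + 1\<close> gaps between consecutive elements consists of \<open>p + i\<close> positions for some \<open>0 \<le> i \<le> p\<close>.
  There are \<open>n + 2p - k\<close> positions in the gaps, so the numbers \<open>i\<close> add up to \<open>n - (p + 1)k + p\<close>, and
  the coefficient of \<open>(1 + x + \<dots> + x\<^sup>p)\<^sup>k\<^sup>+\<^sup>1\<close> at this exponent counts the possibilities. The formal count
  removes the gaps one by one (\<open>card_pointed_Suc\<close>), which is the recursion of the coefficients in
  the exponent of the power (\<open>pbinomial_Suc\<close>).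
\<close>

section \<open>Counting maximal sparse sets\<close>

definition sparse :: "nat \<Rightarrow> nat set \<Rightarrow> bool" where
  "sparse p S \<longleftrightarrow> (\<forall>i\<in>S. \<forall>j\<in>S. i < j \<longrightarrow> i + p < j)"

text \<open>The covering condition makes maximality under inclusion a local property, which can be checked
  gap by gap; the equivalence is \<open>max_sparse_iff_maximal\<close>.\<close>

definition max_sparse :: "nat \<Rightarrow> nat \<Rightarrow> nat set \<Rightarrow> bool" where
  "max_sparse p n S \<longleftrightarrow>
     S \<subseteq> {..<n} \<and> sparse p S \<and> (\<forall>i<n. \<exists>j\<in>S. i \<le> j + p \<and> j \<le> i + p)"

lemma sparse_subset: "sparse p T \<Longrightarrow> S \<subseteq> T \<Longrightarrow> sparse p S"
  unfolding sparse_def by blast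

lemma max_sparse_iff_maximal:
  "max_sparse p n S \<longleftrightarrow>
     S \<subseteq> {..<n} \<and> sparse p S \<and> (\<forall>T. T \<subseteq> {..<n} \<and> sparse p T \<and> S \<subseteq> T \<longrightarrow> T = S)"
proof (intro iffI conjI allI impI)
  fix T assume S: "max_sparse p n S" and T: "T \<subseteq> {..<n} \<and> sparse p T \<and> S \<subseteq> T"
  show "T = S"
  proof (rule ccontr)
    assume "T \<noteq> S"
    with T obtain i where i: "i \<in> T" "i \<notin> S" by blast
    with T S obtain j where j: "j \<in> S" "i \<le> j + p" "j \<le> i + p"
      unfolding max_sparse_def by blast
    have "i < j \<or> j < i" using i j by (metis nat_neq_iff)
    with i j T show False unfolding sparse_def by (meson leD subsetD)
  qed
next
  assume *: "S \<subseteq> {..<n} \<and> sparse p S \<and> (\<forall>T. T \<subseteq> {..<n} \<and> sparse p T \<and> S \<subseteq> T \<longrightarrow> T = S)"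
  have "\<exists>j\<in>S. i \<le> j + p \<and> j \<le> i + p" if "i < n" for i
  proof (rule ccontr)
    assume none: "\<not> (\<exists>j\<in>S. i \<le> j + p \<and> j \<le> i + p)"
    then have "sparse p (insert i S)"
      using * unfolding sparse_def by (auto simp: not_le)
    with * \<open>i < n\<close> have "insert i S = S" by blast
    with none show False by (metis insertI1 le_add1)
  qed
  with * show "max_sparse p n S" unfolding max_sparse_def by blast
qed (auto simp: max_sparse_def)

text \<open>Removal of the first gap. The element \<open>0\<close> covers the positions up to \<open>p\<close>, so the conditions on
  the part from \<open>d\<close> on are not affected by it. The positions from \<open>p + 1\<close> to \<open>d - 1\<close> have to be covered
  from above: there are none if \<open>d = p + 1\<close>, and otherwise the element \<open>d\<close>, which comes from \<open>0 \<in> S\<close>,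
  covers them because \<open>d \<le> 2p + 1\<close>.\<close>

lemma max_sparse_shift:
  assumes "d = p + 1 \<or> p < d \<and> d \<le> 2 * p + 1 \<and> 0 \<in> S"
  shows "max_sparse p (n + d) (insert 0 ((+) d ` S)) \<longleftrightarrow> max_sparse p n S"
proof -
  have "p < d" using assms by auto
  have "insert 0 ((+) d ` S) \<subseteq> {..<n + d} \<longleftrightarrow> S \<subseteq> {..<n}"
    using \<open>p < d\<close> by auto
  moreover have "sparse p (insert 0 ((+) d ` S)) \<longleftrightarrow> sparse p S"
    using \<open>p < d\<close> unfolding sparse_def by auto
  moreover have "(\<forall>i<n + d. \<exists>j\<in>insert 0 ((+) d ` S). i \<le> j + p \<and> j \<le> i + p) \<longleftrightarrow>
      (\<forall>i<n. \<exists>j\<in>S. i \<le> j + p \<and> j \<le> i + p)" (is "?L \<longleftrightarrow> ?R")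
  proof
    assume L: ?L
    show ?R
    proof (intro allI impI)
      fix i assume "i < n"
      then have "i + d < n + d" by simp
      with L have "\<exists>j\<in>insert 0 ((+) d ` S). i + d \<le> j + p \<and> j \<le> i + d + p" by blast
      then show "\<exists>j\<in>S. i \<le> j + p \<and> j \<le> i + p" using \<open>p < d\<close> by auto
    qed
  next
    assume R: ?R
    show ?L
    proof (intro allI impI)
      fix i assume "i < n + d"
      consider "i \<le> p" | "p < i" "i < d" | "d \<le> i" by linarith
      then show "\<exists>j\<in>insert 0 ((+) d ` S). i \<le> j + p \<and> j \<le> i + p"
      proof cases
        case 2
        then have "d \<in> (+) d ` S" "d \<le> i + p" using assms by auto
        with 2 show ?thesis by (intro bexI[of _ d]) auto
      next
        case 3
        with R \<open>i < n + d\<close> obtain j where "j \<in> S" "i - d \<le> j + p" "j \<le> i - d + p"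
          by (metis less_diff_conv2)
        with 3 show ?thesis by (intro bexI[of _ "d + j"]) auto
      qed auto
    qed
  qed
  ultimately show ?thesis unfolding max_sparse_def by simp
qed

text \<open>The sets that start with an element at \<open>0\<close>. They have a uniform recursion: the part from the
  second element on, moved to the origin, is again such a set.\<close>

definition pointed :: "nat \<Rightarrow> nat \<Rightarrow> nat \<Rightarrow> nat set set" where
  "pointed p n k = {S. max_sparse p n S \<and> 0 \<in> S \<and> card S = Suc k}"

lemma finite_max_sparse: "max_sparse p n S \<Longrightarrow> finite S"
  unfolding max_sparse_def using finite_subset by blast

lemma finite_pointed: "finite (pointed p n k)"
  by (rule finite_subset[of _ "Pow {..<n}"]) (auto simp: pointed_def max_sparse_def)

lemma pointed_0: "pointed p n 0 = (if 0 < n \<and> n \<le> p + 1 then {{0}} else {})"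
proof -
  have "max_sparse p n {0} \<longleftrightarrow> 0 < n \<and> n \<le> p + 1"
  proof
    assume *: "max_sparse p n {0}"
    then have "0 < n" unfolding max_sparse_def by simp
    with * have "n - 1 \<le> 0 + p" unfolding max_sparse_def by (metis diff_less singletonD zero_less_one)
    with \<open>0 < n\<close> show "0 < n \<and> n \<le> p + 1" by simp
  qed (auto simp: max_sparse_def sparse_def)
  then show ?thesis unfolding pointed_def by (auto simp: card_1_singleton_iff)
qed

lemma unshift:
  assumes "0 \<in> T" "\<forall>x\<in>T - {0}. d \<le> x" "0 < (d::nat)"
  shows "T = insert 0 ((+) d ` ((\<lambda>x. x - d) ` (T - {0})))"
proof -
  have "(+) d ` ((\<lambda>x. x - d) ` (T - {0})) = id ` (T - {0})"
    unfolding image_image using assms by (intro image_cong) auto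
  with assms show ?thesis by auto
qed

lemma inj_shift:
  assumes "0 < (d::nat)"
  shows "inj (\<lambda>S. insert 0 ((+) d ` S))"
proof (rule injI)
  fix S T assume "insert 0 ((+) d ` S) = insert 0 ((+) d ` T)"
  moreover have "0 \<notin> (+) d ` S" "0 \<notin> (+) d ` T" using assms by auto
  ultimately have "(+) d ` S = (+) d ` T" by (rule insert_ident[THEN iffD1, rotated 2])
  then show "S = T" by (simp add: inj_image_eq_iff)
qed

lemma card_shift:
  assumes "0 < (d::nat)" "finite S"
  shows "card (insert 0 ((+) d ` S)) = Suc (card S)"
  using assms by (simp add: card_image image_iff)

text \<open>The second element \<open>d\<close> exceeds \<open>p\<close> by sparsity, and it is at most \<open>2p + 1\<close> because otherwise
  position \<open>p + 1\<close> would be too far from both \<open>0\<close> and \<open>d\<close>.\<close>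

lemma pointed_Suc:
  "pointed p n (Suc k) = (\<Union>d\<in>{p + 1..2 * p + 1}. (\<lambda>S. insert 0 ((+) d ` S)) ` pointed p (n - d) k)"
proof (intro subset_antisym subsetI)
  fix T assume "T \<in> pointed p n (Suc k)"
  then have T: "max_sparse p n T" "0 \<in> T" "card T = Suc (Suc k)"
    unfolding pointed_def by auto
  have fin: "finite T" by (rule finite_max_sparse[OF T(1)])
  define d where "d = Min (T - {0})"
  have "T - {0} \<noteq> {}" using T fin by (metis card_Diff_singleton card.empty diff_Suc_1 nat.distinct(1))
  then have d: "d \<in> T" "d \<noteq> 0" and le: "\<forall>x\<in>T - {0}. d \<le> x"
    using Min_in[of "T - {0}"] fin unfolding d_def by auto
  have "p < d" using T d unfolding max_sparse_def sparse_def by fastforce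
  have "d < n" using T d unfolding max_sparse_def by auto
  have "d \<le> 2 * p + 1"
    \<comment> \<open>The element that covers position \<open>p + 1\<close> is positive, hence not below \<open>d\<close>.\<close>
  proof -
    have "p + 1 < n" using \<open>p < d\<close> \<open>d < n\<close> by simp
    then obtain j where j: "j \<in> T" "p + 1 \<le> j + p" "j \<le> p + 1 + p"
      using T unfolding max_sparse_def by blast
    then have "j \<in> T - {0}" by auto
    then have "d \<le> j" using le by blast
    then show ?thesis using j by simp
  qed
  define S where "S = (\<lambda>x. x - d) ` (T - {0})"
  have TS: "T = insert 0 ((+) d ` S)"
    unfolding S_def using T(2) le \<open>p < d\<close> by (intro unshift) auto
  have "finite S" "0 \<in> S" unfolding S_def using fin d by (auto simp: image_iff)
  moreover have "max_sparse p (n - d) S"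
    using T(1) max_sparse_shift[of d p S "n - d"] \<open>p < d\<close> \<open>d \<le> 2 * p + 1\<close> \<open>0 \<in> S\<close> \<open>d < n\<close>
    unfolding TS by simp
  moreover have "card S = Suc k"
    using T(3) card_shift[of d S] \<open>finite S\<close> \<open>p < d\<close> unfolding TS by simp
  ultimately have "S \<in> pointed p (n - d) k" unfolding pointed_def by simp
  moreover have "d \<in> {p + 1..2 * p + 1}" using \<open>p < d\<close> \<open>d \<le> 2 * p + 1\<close> by simp
  ultimately show "T \<in> (\<Union>d\<in>{p + 1..2 * p + 1}. (\<lambda>S. insert 0 ((+) d ` S)) ` pointed p (n - d) k)"
    using TS by blast
next
  fix T assume "T \<in> (\<Union>d\<in>{p + 1..2 * p + 1}. (\<lambda>S. insert 0 ((+) d ` S)) ` pointed p (n - d) k)"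
  then obtain d S where d: "d \<in> {p + 1..2 * p + 1}" and S: "S \<in> pointed p (n - d) k"
    and T: "T = insert 0 ((+) d ` S)" by blast
  from d have d: "p < d" "d \<le> 2 * p + 1" by auto
  have S': "max_sparse p (n - d) S" "0 \<in> S" "card S = Suc k"
    using S unfolding pointed_def by auto
  then have "d < n" unfolding max_sparse_def by auto
  then have "max_sparse p n T"
    using max_sparse_shift[of d p S "n - d"] S' d T by simp
  moreover have "card T = Suc (Suc k)"
    using card_shift[of d S] finite_max_sparse[OF S'(1)] S' d T by simp
  ultimately show "T \<in> pointed p n (Suc k)" using T unfolding pointed_def by simp
qed

text \<open>The union over \<open>d\<close> is disjoint, since \<open>d\<close> is the second smallest element of the set. The
  truncated difference is harmless: \<open>pointed p 0 k\<close> is empty.\<close>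

lemma card_pointed_Suc:
  "card (pointed p n (Suc k)) = (\<Sum>i\<le>p. card (pointed p (n - (p + 1 + i)) k))"
proof -
  let ?f = "\<lambda>d S. insert 0 ((+) d ` S)"
  have "card (pointed p n (Suc k)) = (\<Sum>d\<in>{p + 1..2 * p + 1}. card (?f d ` pointed p (n - d) k))"
    unfolding pointed_Suc
  proof (rule card_UN_disjoint)
    have less: "?f d ` pointed p (n - d) k \<inter> ?f e ` pointed p (n - e) k = {}"
      if "p < d" "d < e" for d e
    proof (rule equals0I)
      fix T assume "T \<in> ?f d ` pointed p (n - d) k \<inter> ?f e ` pointed p (n - e) k"
      then have T: "T \<in> ?f d ` pointed p (n - d) k" "T \<in> ?f e ` pointed p (n - e) k" by simp_all
      from T(1) obtain S where "T = ?f d S" "S \<in> pointed p (n - d) k" by (rule imageE)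
      then have "d \<in> T" unfolding pointed_def by (auto simp: image_iff)
      moreover from T(2) obtain S' where "T = ?f e S'" by (rule imageE)
      then have "d \<notin> T" using that by auto
      ultimately show False by contradiction
    qed
    show "\<forall>d\<in>{p + 1..2 * p + 1}. \<forall>e\<in>{p + 1..2 * p + 1}. d \<noteq> e \<longrightarrow>
        ?f d ` pointed p (n - d) k \<inter> ?f e ` pointed p (n - e) k = {}"
    proof (intro ballI impI)
      fix d e assume "d \<in> {p + 1..2 * p + 1}" "e \<in> {p + 1..2 * p + 1}" "d \<noteq> e"
      then have "p < d" "p < e" "d < e \<or> e < d" by auto
      then show "?f d ` pointed p (n - d) k \<inter> ?f e ` pointed p (n - e) k = {}"
        using less[of d e] less[of e d] by (metis Int_commute)
    qed
  qed (auto simp: finite_pointed)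
  also have "\<dots> = (\<Sum>d\<in>{p + 1..2 * p + 1}. card (pointed p (n - d) k))"
    by (intro sum.cong refl card_image inj_on_subset[OF inj_shift]) auto
  also have "\<dots> = (\<Sum>i\<le>p. card (pointed p (n - (p + 1 + i)) k))"
    by (rule sum.reindex_bij_witness[of _ "\<lambda>i. p + 1 + i" "\<lambda>d. d - (p + 1)"]) auto
  finally show ?thesis .
qed

lemma pbinomial_Suc: "pbinomial p (Suc b) a = (\<Sum>i\<le>p. pbinomial p b (a - int i))"
proof (cases "a < 0")
  case True
  then show ?thesis unfolding pbinomial_def by simp
next
  case False
  define P :: "nat poly" where "P = (\<Sum>i\<le>p. monom 1 i)"
  have "poly.coeff (P ^ Suc b) (nat a) = poly.coeff (\<Sum>i\<le>p. monom 1 i * P ^ b) (nat a)"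
    by (simp add: P_def sum_distrib_right)
  also have "\<dots> = (\<Sum>i\<le>p. if i \<le> nat a then poly.coeff (P ^ b) (nat a - i) else 0)"
    by (auto simp: coeff_sum coeff_monom_mult intro!: sum.cong)
  also have "\<dots> = (\<Sum>i\<le>p. pbinomial p b (a - int i))"
    using False by (intro sum.cong) (auto simp: pbinomial_def P_def nat_diff_distrib)
  finally show ?thesis using False by (simp add: pbinomial_def P_def)
qed

lemma pbinomial_1: "pbinomial p 1 a = (if 0 \<le> a \<and> a \<le> int p then 1 else 0)"
  by (auto simp: pbinomial_def coeff_sum)

text \<open>Position \<open>0\<close> and the \<open>k\<close> further elements, each with at least \<open>p\<close> positions in front of it, use
  \<open>1 + (p + 1)k\<close> of the \<open>n\<close> positions; the others are the excesses of \<open>k\<close> inner gaps and the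
  final gap, each between \<open>0\<close> and \<open>p\<close>.\<close>

lemma card_pointed:
  "card (pointed p n k) = pbinomial p (Suc k) (int n - 1 - (int p + 1) * int k)"
proof (induction k arbitrary: n)
  case 0
  show ?case using pbinomial_1[of p "int n - 1"] by (auto simp: pointed_0)
next
  case (Suc k)
  have "card (pointed p (n - (p + 1 + i)) k)
      = pbinomial p (Suc k) (int n - 1 - (int p + 1) * int (Suc k) - int i)" for i
  proof (cases "p + 1 + i \<le> n")
    case True
    then show ?thesis by (simp add: Suc.IH of_nat_diff algebra_simps)
  next
    case False
    \<comment> \<open>The gap does not fit, and the exponent on the right is negative.\<close>
    then have "int n < int p + 1 + int i" by simp
    moreover have "0 \<le> int p * int k" by simp
    ultimately have "int n - 1 - (int p + 1) * int (Suc k) - int i < 0"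
      unfolding of_nat_Suc ring_distribs by linarith
    moreover have "pointed p (n - (p + 1 + i)) k = {}"
      using False unfolding pointed_def max_sparse_def by auto
    ultimately show ?thesis by (simp add: pbinomial_def)
  qed
  then show ?case unfolding card_pointed_Suc pbinomial_Suc by simp
qed

text \<open>An additional element at distance \<open>p + 1\<close> before the origin turns an arbitrary maximal sparse
  set into a pointed one: it covers exactly the new positions, and its distance from the elements of
  the given set is large enough.\<close>

lemma card_max_sparse:
  "card {S. max_sparse p n S \<and> card S = k}
     = pbinomial p (k + 1) (int n - (int p + 1) * int k + int p)"
proof -
  let ?f = "\<lambda>S. insert 0 ((+) (p + 1) ` S)"
  have "pointed p (n + (p + 1)) k = ?f ` {S. max_sparse p n S \<and> card S = k}"
  proof (intro subset_antisym subsetI)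
    fix T assume "T \<in> pointed p (n + (p + 1)) k"
    then have T: "max_sparse p (n + (p + 1)) T" "0 \<in> T" "card T = Suc k"
      unfolding pointed_def by auto
    define S where "S = (\<lambda>x. x - (p + 1)) ` (T - {0})"
    have "\<forall>x\<in>T - {0}. p + 1 \<le> x"
    proof
      fix x assume "x \<in> T - {0}"
      then have "x \<in> T" "0 < x" by auto
      with T(1,2) have "0 + p < x" unfolding max_sparse_def sparse_def by blast
      then show "p + 1 \<le> x" by simp
    qed
    then have TS: "T = ?f S" unfolding S_def using T(2) by (intro unshift) auto
    have "finite S" unfolding S_def using finite_max_sparse[OF T(1)] by simp
    then have "card S = k" using T(3) card_shift[of "p + 1" S] unfolding TS by simp
    moreover have "max_sparse p n S"
      using T(1) max_sparse_shift[of "p + 1" p S n] unfolding TS by simp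
    ultimately show "T \<in> ?f ` {S. max_sparse p n S \<and> card S = k}" using TS by blast
  next
    fix T assume "T \<in> ?f ` {S. max_sparse p n S \<and> card S = k}"
    then obtain S where S: "max_sparse p n S" "card S = k" and T: "T = ?f S" by blast
    have "card T = Suc k" using card_shift[of "p + 1" S] finite_max_sparse[OF S(1)] S T by simp
    moreover have "max_sparse p (n + (p + 1)) T"
      using max_sparse_shift[of "p + 1" p S n] S T by simp
    ultimately show "T \<in> pointed p (n + (p + 1)) k" unfolding pointed_def T by simp
  qed
  then have "card {S. max_sparse p n S \<and> card S = k} = card (pointed p (n + (p + 1)) k)"
    using card_image[OF inj_on_subset[OF inj_shift subset_UNIV, of "p + 1"]] by simp
  then show ?thesis by (simp add: card_pointed algebra_simps)
qed

section \<open>The top vertex of a subcube\<close>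

text \<open>Adjacency in a hypercube, for vertices given by their sets of 1s.\<close>

definition adjacent :: "'a set \<Rightarrow> 'a set \<Rightarrow> bool" where
  "adjacent A B \<longleftrightarrow> (\<exists>c. sym_diff A B = {c})"

lemma adjacentE:
  assumes "adjacent A B"
  obtains c where "c \<notin> A" "B = insert c A" | c where "c \<notin> B" "A = insert c B"
proof -
  from assms obtain c where c: "sym_diff A B = {c}" unfolding adjacent_def by blast
  have iff: "(x \<in> A \<longleftrightarrow> x \<notin> B) \<longleftrightarrow> x = c" for x
    using arg_cong[OF c, of "\<lambda>S. x \<in> S"] by auto
  show thesis
  proof (cases "c \<in> A")
    case True
    then have "c \<notin> B" using iff by blast
    moreover have "A = insert c B"
    proof (rule set_eqI)
      show "x \<in> A \<longleftrightarrow> x \<in> insert c B" for x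
        using iff[of x] True by (cases "x = c") simp_all
    qed
    ultimately show thesis by (rule that(2))
  next
    case False
    moreover have "B = insert c A"
    proof (rule set_eqI)
      show "x \<in> B \<longleftrightarrow> x \<in> insert c A" for x
        using iff[of x] False by (cases "x = c") auto
    qed
    ultimately show thesis by (rule that(1))
  qed
qed

text \<open>If \<open>Z1 = Z - {a}\<close> and \<open>Z2 = Z - {b}\<close>, then the only common neighbours of \<open>Z1\<close> and \<open>Z2\<close> are \<open>Z\<close>
  and \<open>Z - {a, b}\<close>.\<close>

lemma four_cycle_descends:
  assumes "adjacent Z Z1" "Z1 \<subset> Z" "adjacent Z Z2" "Z2 \<subset> Z" "Z1 \<noteq> Z2"
    and "adjacent Z1 Y" "adjacent Z2 Y" "Y \<noteq> Z"
  shows "Y \<subset> Z1"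
proof -
  obtain a where a: "a \<notin> Z1" "Z = insert a Z1" using assms(1,2) by (auto elim: adjacentE)
  obtain b where b: "b \<notin> Z2" "Z = insert b Z2" using assms(3,4) by (auto elim: adjacentE)
  have "Z1 = Z - {a}" "Z2 = Z - {b}" using a b by blast+
  with \<open>Z1 \<noteq> Z2\<close> have "a \<noteq> b" by blast
  have "b \<in> Z" unfolding b(2) by simp
  then have "b \<in> Z1" using \<open>a \<noteq> b\<close> unfolding \<open>Z1 = Z - {a}\<close> by blast
  have "Z2 \<subseteq> Z" unfolding b(2) by blast
  show ?thesis
    using assms(6)
  proof (cases rule: adjacentE)
    case (1 c)
    \<comment> \<open>Adding a new element to \<open>Z1\<close> gives a set with two elements outside \<open>Z2\<close>.\<close>
    have "c \<noteq> a" using 1(2) a(2) \<open>Y \<noteq> Z\<close> by blast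
    then have "c \<notin> Z" using 1(1) unfolding a(2) by simp
    then have "b \<in> Y - Z2" "c \<in> Y - Z2" "b \<noteq> c"
      using \<open>Z2 \<subseteq> Z\<close> \<open>b \<notin> Z2\<close> \<open>b \<in> Z\<close> \<open>b \<in> Z1\<close> unfolding 1(2) by blast+
    then have "\<not> adjacent Z2 Y" unfolding adjacent_def by blast
    with assms(7) show ?thesis by contradiction
  next
    case (2 c)
    then show ?thesis by auto
  qed
qed

text \<open>The map \<open>h\<close> embeds the hypercube on \<open>Pow I\<close> into another one. Choose \<open>X\<close> such that \<open>h X\<close> has the
  largest cardinality, and move it to the origin by the automorphism \<open>A \<mapsto> sym_diff X A\<close>. Then each
  element that is added to \<open>A\<close> makes the image smaller. For \<open>A = {i}\<close> this is the choice of \<open>X\<close>; for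
  larger sets it follows by induction from the 4-cycle \<open>A - {i, j}\<close>, \<open>A - {i}\<close>, \<open>A\<close>, \<open>A - {j}\<close>.\<close>

lemma cube_has_top:
  fixes h :: "'a set \<Rightarrow> 'b set"
  assumes "finite I" and inj: "inj_on h (Pow I)"
    and fin: "\<And>A. A \<subseteq> I \<Longrightarrow> finite (h A)"
    and adj: "\<And>A B. A \<subseteq> I \<Longrightarrow> B \<subseteq> I \<Longrightarrow> adjacent A B \<Longrightarrow> adjacent (h A) (h B)"
  obtains B where "B \<subseteq> I" "\<And>A. A \<subseteq> I \<Longrightarrow> h A \<subseteq> h B"
proof -
  have "finite ((card \<circ> h) ` Pow I)" using \<open>finite I\<close> by simp
  moreover have "(card \<circ> h) ` Pow I \<noteq> {}" by blast
  ultimately have "Max ((card \<circ> h) ` Pow I) \<in> (card \<circ> h) ` Pow I" by (rule Max_in)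
  then obtain X where X: "X \<subseteq> I" and "card (h X) = Max ((card \<circ> h) ` Pow I)" by auto
  then have max: "card (h A) \<le> card (h X)" if "A \<subseteq> I" for A
    using that \<open>finite ((card \<circ> h) ` Pow I)\<close> by simp
  define g where "g A = h (sym_diff X A)" for A
  have g_adj: "adjacent (g A) (g (insert i A))" if "A \<subseteq> I" "i \<in> I" "i \<notin> A" for A i
    unfolding g_def
  proof (rule adj)
    have "sym_diff (sym_diff X A) (sym_diff X (insert i A)) = {i}" using that by auto
    then show "adjacent (sym_diff X A) (sym_diff X (insert i A))" unfolding adjacent_def by blast
  qed (use X that in auto)
  have g_inj: "A = B" if "g A = g B" "A \<subseteq> I" "B \<subseteq> I" for A B
  proof -
    have "sym_diff X A = sym_diff X B"
      using inj_onD[OF inj that(1)[unfolded g_def]] X that(2,3) by blast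
    then show ?thesis by blast
  qed
  have step: "g A \<subset> g (A - {i})" if "A \<subseteq> I" "i \<in> A" for A i
    using finite_subset[OF that(1) \<open>finite I\<close>] that
  proof (induction A arbitrary: i rule: finite_psubset_induct)
    case (psubset A)
    show ?case
    proof (cases "A = {i}")
      case True
      have "adjacent (g {}) (g {i})" using psubset.prems by (intro g_adj) auto
      then show ?thesis
      proof (cases rule: adjacentE)
        case (1 c)
        have "card (g {}) < card (g {i})" using fin[OF X] 1 by (simp add: g_def)
        moreover have "card (g {i}) \<le> card (g {})"
          unfolding g_def using max[of "sym_diff X {i}"] X psubset.prems by auto
        ultimately show ?thesis by simp
      next
        case (2 c)
        then show ?thesis using True by auto
      qed
    next
      case False
      then obtain j where j: "j \<in> A" "j \<noteq> i" using psubset.prems by blast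
      let ?Z = "A - {i} - {j}"
      have eq: "A - {j} - {i} = ?Z" by blast
      show ?thesis
      proof (rule four_cycle_descends)
        show "g (A - {i}) \<subset> g ?Z" using psubset j by (intro psubset.IH) auto
        show "g (A - {j}) \<subset> g ?Z" unfolding eq[symmetric] using psubset j by (intro psubset.IH) auto
        have ins: "insert j ?Z = A - {i}" "insert i ?Z = A - {j}"
          "insert i (A - {i}) = A" "insert j (A - {j}) = A"
          using psubset.prems j by auto
        show "adjacent (g ?Z) (g (A - {i}))" "adjacent (g ?Z) (g (A - {j}))"
          using g_adj[of ?Z j] g_adj[of ?Z i] psubset.prems j unfolding ins by auto
        show "adjacent (g (A - {i})) (g A)" "adjacent (g (A - {j})) (g A)"
          using g_adj[of "A - {i}" i] g_adj[of "A - {j}" j] psubset.prems j unfolding ins by auto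
        show "g (A - {i}) \<noteq> g (A - {j})" "g A \<noteq> g ?Z"
          using g_inj[of "A - {i}" "A - {j}"] g_inj[of A ?Z] psubset.prems j by blast+
      qed
    qed
  qed
  have le_top: "g A \<subseteq> g {}" if "A \<subseteq> I" for A
    using finite_subset[OF that \<open>finite I\<close>] that
  proof (induction A rule: finite_induct)
    case (insert i A)
    then have "g (insert i A) \<subset> g A" using step[of "insert i A" i] by simp
    with insert show ?case by auto
  qed simp
  have "h A \<subseteq> h X" if "A \<subseteq> I" for A
  proof -
    have "sym_diff X (sym_diff X A) = A" by blast
    moreover have "sym_diff X A \<subseteq> I" using X that by blast
    ultimately show ?thesis using le_top[of "sym_diff X A"] by (simp add: g_def)
  qed
  with X show thesis by (rule that)
qed

section \<open>Strings as sets of positions\<close>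

definition ones :: "bool list \<Rightarrow> nat set" where
  "ones w = {i. i < length w \<and> w ! i}"

definition word :: "nat \<Rightarrow> nat set \<Rightarrow> bool list" where
  "word n A = map (\<lambda>i. i \<in> A) [0..<n]"

lemma length_word [simp]: "length (word n A) = n"
  by (simp add: word_def)

lemma ones_word: "A \<subseteq> {..<n} \<Longrightarrow> ones (word n A) = A"
  by (auto simp: ones_def word_def)

lemma word_ones: "length w = n \<Longrightarrow> word n (ones w) = w"
  by (auto simp: ones_def word_def intro: nth_equalityI)

lemma ones_subset: "ones w \<subseteq> {..<length w}"
  by (auto simp: ones_def)

text \<open>The condition on successive 1s implies the one on all pairs: the last 1 before position \<open>j\<close> is
  already more than \<open>p\<close> positions away.\<close>

lemma fibonacci_string_iff_sparse: "fibonacci_string p w \<longleftrightarrow> sparse p (ones w)"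
proof
  assume fib: "fibonacci_string p w"
  show "sparse p (ones w)"
    unfolding sparse_def
  proof (intro ballI impI)
    fix i j assume ij: "i \<in> ones w" "j \<in> ones w" "i < j"
    define L where "L = {l. i \<le> l \<and> l < j \<and> w ! l}"
    have "finite L" unfolding L_def by simp
    have "i \<in> L" using ij unfolding L_def ones_def by simp
    define l where "l = Max L"
    have "l \<in> L" unfolding l_def using \<open>finite L\<close> \<open>i \<in> L\<close> by (intro Max_in) auto
    moreover have "\<not> w ! m" if "l < m" "m < j" for m
    proof
      assume "w ! m"
      with that \<open>l \<in> L\<close> have "m \<in> L" unfolding L_def by simp
      then have "m \<le> l" unfolding l_def using \<open>finite L\<close> by simp
      with that show False by simp
    qed
    ultimately have "p \<le> j - l - 1"
      using fib ij unfolding fibonacci_string_def L_def ones_def by blast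
    with \<open>l \<in> L\<close> show "i + p < j" unfolding L_def by auto
  qed
next
  assume "sparse p (ones w)"
  then show "fibonacci_string p w"
    unfolding fibonacci_string_def sparse_def ones_def by fastforce
qed

lemma verts_hypercube: "verts (hypercube n) = {w. length w = n}"
  and tail_hypercube: "tail (hypercube n) = fst"
  and head_hypercube: "head (hypercube n) = snd"
  by (simp_all add: hypercube_def)

lemma arcs_hypercube:
  "arcs (hypercube n) = {(u, v). length u = n \<and> length v = n \<and> adjacent (ones u) (ones v)}"
proof -
  have *: "(\<exists>!i. i < n \<and> u ! i \<noteq> v ! i) \<longleftrightarrow> adjacent (ones u) (ones v)"
    if "length u = n" "length v = n" for u v
  proof -
    have "sym_diff (ones u) (ones v) = {i. i < n \<and> u ! i \<noteq> v ! i}"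
      using that by (auto simp: ones_def)
    moreover have "(\<exists>!i. P i) \<longleftrightarrow> (\<exists>c. {i. P i} = {c})" for P :: "nat \<Rightarrow> bool"
    proof
      assume "\<exists>!i. P i"
      then show "\<exists>c. {i. P i} = {c}" by (elim ex1E) blast
    next
      assume "\<exists>c. {i. P i} = {c}"
      then obtain c where c: "{i. P i} = {c}" by blast
      have "P i \<longleftrightarrow> i = c" for i using c by blast
      then show "\<exists>!i. P i" by simp
    qed
    ultimately show ?thesis unfolding adjacent_def by simp
  qed
  have "arcs (hypercube n)
      = {(u, v). length u = n \<and> length v = n \<and> (\<exists>!i. i < n \<and> u ! i \<noteq> v ! i)}"
    by (simp add: hypercube_def)
  also have "\<dots> = {(u, v). length u = n \<and> length v = n \<and> adjacent (ones u) (ones v)}"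
    by (intro Collect_cong prod.case_cong conj_cong refl *)
  finally show ?thesis .
qed

lemmas hypercube_simps = verts_hypercube tail_hypercube head_hypercube arcs_hypercube

lemma wf_hypercube: "wf_digraph (hypercube n)"
  using graph_hypercube[of n] by (simp add: graph_def digraph_def fin_digraph_def)

section \<open>Hypercubes inside a hypercube\<close>

definition below :: "nat \<Rightarrow> nat set \<Rightarrow> bool list set" where
  "below n S = {w. length w = n \<and> ones w \<subseteq> S}"

text \<open>An enumeration \<open>\<sigma>\<close> of \<open>S\<close> transports strings of length \<open>card S\<close> to the strings below \<open>S\<close>. Images
  under an injective map commute with symmetric differences, so adjacency is preserved in both
  directions.\<close>

lemma hypercube_iso_below:
  assumes "S \<subseteq> {..<n}"
  shows "digraph_iso (hypercube n \<restriction> below n S) (hypercube (card S))"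
proof -
  have "finite S" using assms finite_subset by blast
  then obtain \<sigma> where \<sigma>: "bij_betw \<sigma> {..<card S} S"
    using ex_bij_betw_nat_finite[of S, unfolded atLeast0LessThan] by blast
  then have inj: "inj_on \<sigma> {..<card S}" by (rule bij_betw_imp_inj_on)
  have image_\<sigma>: "\<sigma> ` {..<card S} = S" using \<sigma> by (rule bij_betw_imp_surj_on)
  define f where "f v = word n (\<sigma> ` ones v)" for v
  have sub: "\<sigma> ` ones v \<subseteq> S" if "length v = card S" for v
    using image_mono[OF ones_subset[of v], of \<sigma>] that image_\<sigma> by simp
  have ones_f: "ones (f v) = \<sigma> ` ones v" if "length v = card S" for v
    unfolding f_def by (rule ones_word) (rule subset_trans[OF sub[OF that] assms])
  have eq_iff: "\<sigma> ` A = \<sigma> ` B \<longleftrightarrow> A = B" if "A \<subseteq> {..<card S}" "B \<subseteq> {..<card S}" for A B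
    using inj_on_image_eq_iff[OF inj that] .
  have inj_f: "inj_on f {v. length v = card S}"
  proof (rule inj_onI)
    fix u v assume uv: "u \<in> {v. length v = card S}" "v \<in> {v. length v = card S}" "f u = f v"
    then have "\<sigma> ` ones u = \<sigma> ` ones v" using ones_f by (metis mem_Collect_eq)
    then have "ones u = ones v" 
      using eq_iff[of "ones u" "ones v"] ones_subset[of u] ones_subset[of v] uv by simp
    moreover have "word (card S) (ones u) = u" "word (card S) (ones v) = v"
      using uv(1,2) by (auto intro: word_ones)
    ultimately show "u = v" by metis
  qed
  have image_f: "f ` {v. length v = card S} = below n S"
  proof (intro subset_antisym subsetI)
    fix w assume w: "w \<in> below n S"
    define A where "A = {i\<in>{..<card S}. \<sigma> i \<in> ones w}"
    have "\<sigma> ` A = ones w" using \<sigma> w unfolding A_def bij_betw_def below_def by auto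
    moreover have "ones (word (card S) A) = A" by (rule ones_word) (auto simp: A_def)
    ultimately have "f (word (card S) A) = w"
      using w unfolding f_def below_def by (simp add: word_ones)
    then show "w \<in> f ` {v. length v = card S}" by force
  next
    fix w assume "w \<in> f ` {v. length v = card S}"
    then obtain v where "length v = card S" "w = f v" by blast
    then show "w \<in> below n S" using ones_f sub unfolding below_def by (auto simp: f_def)
  qed
  have adj_f: "adjacent (ones (f u)) (ones (f v)) \<longleftrightarrow> adjacent (ones u) (ones v)"
    if len: "length u = card S" "length v = card S" for u v
  proof -
    have sub': "ones u \<subseteq> {..<card S}" "ones v \<subseteq> {..<card S}"
      using ones_subset[of u] ones_subset[of v] len by auto
    have "sym_diff (\<sigma> ` ones u) (\<sigma> ` ones v) = \<sigma> ` sym_diff (ones u) (ones v)"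
    proof -
      have "\<sigma> ` (A - B) = \<sigma> ` A - \<sigma> ` B" if "A \<subseteq> {..<card S}" "B \<subseteq> {..<card S}" for A B
        using that by (intro inj_on_image_set_diff[OF inj]) auto
      then show ?thesis using sub' by (simp add: image_Un)
    qed
    moreover have "card (\<sigma> ` sym_diff (ones u) (ones v)) = card (sym_diff (ones u) (ones v))"
      using sub' by (intro card_image inj_on_subset[OF inj]) blast
    ultimately show ?thesis
      unfolding adjacent_def card_1_singleton_iff[symmetric] ones_f[OF len(1)] ones_f[OF len(2)]
      by simp
  qed
  define hom where "hom = \<lparr> iso_verts = f, iso_arcs = map_prod f f, iso_head = snd, iso_tail = fst \<rparr>"
  have "pre_digraph.digraph_isomorphism (hypercube (card S)) hom"
    unfolding pre_digraph.digraph_isomorphism_def hom_def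
  proof (simp, intro conjI)
    show "inj_on (map_prod f f) (arcs (hypercube (card S)))"
      by (rule inj_on_subset[OF map_prod_inj_on[OF inj_f inj_f]]) (auto simp: hypercube_simps)
  qed (use inj_f wf_hypercube in \<open>auto simp: hypercube_simps\<close>)
  moreover have "hypercube n \<restriction> below n S = app_iso hom (hypercube (card S))"
  proof (rule pre_digraph.equality)
    show "arcs (hypercube n \<restriction> below n S) = arcs (app_iso hom (hypercube (card S)))"
    proof (intro subset_antisym subsetI)
      fix e assume "e \<in> arcs (hypercube n \<restriction> below n S)"
      then obtain u v where e: "e = (u, v)" "u \<in> below n S" "v \<in> below n S"
        "adjacent (ones u) (ones v)"
        by (auto simp: hypercube_simps)
      then obtain u' v' where "length u' = card S" "length v' = card S" "u = f u'" "v = f v'"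
        unfolding image_f[symmetric] by auto
      with e adj_f show "e \<in> arcs (app_iso hom (hypercube (card S)))"
        by (auto simp: hom_def hypercube_simps)
    next
      fix e assume "e \<in> arcs (app_iso hom (hypercube (card S)))"
      then obtain u v where "length u = card S" "length v = card S" "adjacent (ones u) (ones v)"
        "e = (f u, f v)"
        by (auto simp: hom_def hypercube_simps)
      moreover from this have "f u \<in> below n S" "f v \<in> below n S"
        unfolding image_f[symmetric] by auto
      ultimately show "e \<in> arcs (hypercube n \<restriction> below n S)"
        using adj_f by (auto simp: hypercube_simps below_def)
    qed
  qed (simp_all add: hom_def hypercube_simps image_f)
  ultimately have "digraph_iso (hypercube (card S)) (hypercube n \<restriction> below n S)"
    unfolding digraph_iso_def by blast
  then show ?thesis by (rule digraph_iso_swap[OF wf_hypercube])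
qed

text \<open>An isomorphism of digraphs comes with separate maps for vertices and arcs, and arcs of a subgraph of
  \<open>Q\<^sub>n\<close> are determined by their ends. This reduces it to a map of vertices that preserves adjacency,
  the form in which \<open>cube_has_top\<close> applies.\<close>

lemma iso_hypercube_labelling:
  assumes sub: "subgraph H (hypercube n)" and iso: "digraph_iso H (hypercube k)"
  obtains f where "bij_betw f {x. length x = k} (verts H)"
    and "\<And>x y. length x = k \<Longrightarrow> length y = k \<Longrightarrow> adjacent (ones x) (ones y) \<Longrightarrow>
           adjacent (ones (f x)) (ones (f y))"
proof -
  have "wf_digraph H" using sub by auto
  from digraph_iso_swap[OF this iso] obtain hom where
    hom: "pre_digraph.digraph_isomorphism (hypercube k) hom" and H: "H = app_iso hom (hypercube k)"
    unfolding digraph_iso_def by blast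
  let ?f = "iso_verts hom"
  have "compatible (hypercube n) H" using sub by auto
  then have ends: "iso_tail hom = fst" "iso_head hom = snd"
    unfolding compatible_def H by (auto simp: hypercube_simps)
  have "bij_betw ?f {x. length x = k} (verts H)"
    using hom unfolding H bij_betw_def pre_digraph.digraph_isomorphism_def
    by (simp add: hypercube_simps)
  moreover have "adjacent (ones (?f x)) (ones (?f y))"
    if "length x = k" "length y = k" "adjacent (ones x) (ones y)" for x y
  proof -
    have arc: "(x, y) \<in> arcs (hypercube k)" using that by (simp add: hypercube_simps)
    then have "iso_arcs hom (x, y) = (?f x, ?f y)"
      using hom unfolding pre_digraph.digraph_isomorphism_def
      by (auto simp: ends hypercube_simps prod_eq_iff)
    moreover have "iso_arcs hom (x, y) \<in> arcs (hypercube n)"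
      using arc sub unfolding H subgraph_def by auto
    ultimately show ?thesis by (simp add: hypercube_simps)
  qed
  ultimately show thesis by (rule that)
qed

lemma card_verts_iso_hypercube:
  assumes "subgraph H (hypercube n)" and "digraph_iso H (hypercube k)"
  shows "card (verts H) = 2 ^ k"
proof -
  obtain f where "bij_betw f {x :: bool list. length x = k} (verts H)"
    using iso_hypercube_labelling[OF assms] by metis
  then have "card (verts H) = card {x :: bool list. length x = k}"
    by (simp add: bij_betw_same_card)
  then show ?thesis using card_lists_length_eq[of "UNIV :: bool set" k] by simp
qed

lemma subcube_has_top:
  assumes "subgraph H (hypercube n)" and "digraph_iso H (hypercube k)"
  obtains t where "t \<in> verts H" "verts H \<subseteq> below n (ones t)"
proof -
  obtain f where f: "bij_betw f {x. length x = k} (verts H)"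
    and adj: "\<And>x y. length x = k \<Longrightarrow> length y = k \<Longrightarrow> adjacent (ones x) (ones y) \<Longrightarrow>
           adjacent (ones (f x)) (ones (f y))"
    using iso_hypercube_labelling[OF assms] by metis
  have H: "verts H \<subseteq> {w. length w = n}"
    using subgraph_imp_subverts[OF assms(1)] by (simp add: verts_hypercube)
  have len: "length (f x) = n" if "length x = k" for x
    using f H that unfolding bij_betw_def by blast
  define h where "h A = ones (f (word k A))" for A
  obtain B where B: "B \<subseteq> {..<k}" "\<And>A. A \<subseteq> {..<k} \<Longrightarrow> h A \<subseteq> h B"
  proof (rule cube_has_top[of "{..<k}" h])
    show "inj_on h (Pow {..<k})"
    proof (rule inj_onI)
      fix A B assume AB: "A \<in> Pow {..<k}" "B \<in> Pow {..<k}" "h A = h B"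
      then have "f (word k A) = f (word k B)"
        using word_ones[OF len[OF length_word[of k A]]] word_ones[OF len[OF length_word[of k B]]]
          AB(3)[unfolded h_def] by metis
      then have "word k A = word k B"
        using f unfolding bij_betw_def inj_on_def by simp
      moreover have "ones (word k A) = A" "ones (word k B) = B"
        using AB(1,2) by (simp_all add: ones_word)
      ultimately show "A = B" by metis
    qed
    show "finite (h A)" for A
      unfolding h_def by (rule finite_subset[OF ones_subset]) simp
    show "adjacent (h A) (h B)" if "A \<subseteq> {..<k}" "B \<subseteq> {..<k}" "adjacent A B" for A B
      unfolding h_def using that by (intro adj) (simp_all add: ones_word)
  qed auto
  define t where "t = f (word k B)"
  have "t \<in> verts H" unfolding t_def by (rule bij_betw_apply[OF f]) simp
  moreover have "verts H \<subseteq> below n (ones t)"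
  proof
    fix w assume "w \<in> verts H"
    then obtain x where x: "length x = k" "w = f x" using f unfolding bij_betw_def by auto
    then have "ones w = h (ones x)" unfolding h_def by (simp add: word_ones)
    also have "\<dots> \<subseteq> h B" using B(2) ones_subset[of x] x by simp
    finally show "w \<in> below n (ones t)"
      using \<open>w \<in> verts H\<close> H unfolding below_def h_def t_def by auto
  qed
  ultimately show thesis by (rule that)
qed

section \<open>Maximal hypercubes and maximal Fibonacci strings\<close>

lemma subgraph_restrict_mono:
  assumes "wf_digraph G" "U \<subseteq> V" "V \<subseteq> verts G"
  shows "subgraph (G \<restriction> U) (G \<restriction> V)"
  using assms by (intro subgraphI)
    (auto simp: compatible_def intro: wf_digraph.wellformed_induce_subgraph)

lemma verts_fibonacci_cube: "verts (fibonacci_cube p n) = {w. length w = n \<and> sparse p (ones w)}"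
  by (simp add: fibonacci_cube_def fibonacci_string_iff_sparse)

lemma induced_subgraph_fibonacci_cube_iff:
  "induced_subgraph H (fibonacci_cube p n) \<longleftrightarrow>
     (\<exists>U \<subseteq> verts (fibonacci_cube p n). H = hypercube n \<restriction> U)"
proof
  assume ind: "induced_subgraph H (fibonacci_cube p n)"
  then have V: "verts H \<subseteq> verts (fibonacci_cube p n)" and "compatible (fibonacci_cube p n) H"
    by auto
  have "H = hypercube n \<restriction> verts H"
  proof (rule pre_digraph.equality)
    show "arcs H = arcs (hypercube n \<restriction> verts H)"
      using ind V unfolding induced_subgraph_def fibonacci_cube_def by auto
    show "tail H = tail (hypercube n \<restriction> verts H)" "head H = head (hypercube n \<restriction> verts H)"
      using \<open>compatible _ H\<close> unfolding compatible_def fibonacci_cube_def by simp_all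
  qed simp_all
  with V show "\<exists>U \<subseteq> verts (fibonacci_cube p n). H = hypercube n \<restriction> U" by blast
next
  assume "\<exists>U \<subseteq> verts (fibonacci_cube p n). H = hypercube n \<restriction> U"
  then obtain U where U: "U \<subseteq> verts (fibonacci_cube p n)" and H: "H = hypercube n \<restriction> U" by blast
  have "subgraph H (fibonacci_cube p n)"
    unfolding H fibonacci_cube_def using U wf_hypercube
    by (intro subgraph_restrict_mono) (auto simp: fibonacci_cube_def verts_hypercube)
  then show "induced_subgraph H (fibonacci_cube p n)"
    using U unfolding H fibonacci_cube_def by (intro induced_subgraphI) auto
qed

lemma below_mono_iff:
  assumes "S \<subseteq> {..<n}"
  shows "below n S \<subseteq> below n T \<longleftrightarrow> S \<subseteq> T"
proof
  assume "below n S \<subseteq> below n T"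
  moreover have "word n S \<in> below n S" using assms by (simp add: below_def ones_word)
  ultimately have "word n S \<in> below n T" by blast
  then show "S \<subseteq> T" using assms by (simp add: below_def ones_word)
qed (auto simp: below_def)

text \<open>Every hypercube of the Fibonacci cube lies in the one spanned by the strings below its top vertex,
  so only the latter can be maximal, and they are ordered by inclusion in the same way as the sets
  that define them. The dimension is recovered from the number \<open>2 ^ k\<close> of vertices.\<close>

lemma maximal_hypercubes_fibonacci_cube:
  "maximal_hypercubes (fibonacci_cube p n) k
     = (\<lambda>S. hypercube n \<restriction> below n S) ` {S. max_sparse p n S \<and> card S = k}"
proof -
  let ?G = "fibonacci_cube p n"
  let ?C = "\<lambda>S. hypercube n \<restriction> below n S"
  have verts_C: "verts (?C S) = below n S" for S
    by simp
  have sub_hypercube: "subgraph H (hypercube n)" if "induced_subgraph H ?G" for H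
    using that induced_subgraph_fibonacci_cube[of p n]
    by (meson induced_imp_subgraph subgraph_trans)
  have C_induced: "induced_subgraph (?C S) ?G" if "sparse p S" for S
    unfolding induced_subgraph_fibonacci_cube_iff verts_fibonacci_cube
    using that by (intro exI[of _ "below n S"]) (auto simp: below_def intro: sparse_subset)
  have inside: "\<exists>S\<subseteq>{..<n}. sparse p S \<and> subgraph H (?C S)"
    if H: "induced_subgraph H ?G" "digraph_iso H (hypercube m)" for H m
  proof -
    obtain t where t: "t \<in> verts H" "verts H \<subseteq> below n (ones t)"
      using subcube_has_top[OF sub_hypercube[OF H(1)] H(2)] by blast
    obtain U where U: "U \<subseteq> verts ?G" "H = hypercube n \<restriction> U"
      using H(1) unfolding induced_subgraph_fibonacci_cube_iff by blast
    have "t \<in> verts ?G" using t(1) U by auto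
    then have "ones t \<subseteq> {..<n}" "sparse p (ones t)"
      using ones_subset[of t] unfolding verts_fibonacci_cube by auto
    moreover have "subgraph H (?C (ones t))"
      using t(2) U(2) wf_hypercube
      by (auto simp: below_def verts_hypercube intro!: subgraph_restrict_mono)
    ultimately show ?thesis by blast
  qed
  show ?thesis
  proof (intro subset_antisym subsetI)
    fix H assume "H \<in> maximal_hypercubes ?G k"
    then have H: "induced_subgraph H ?G" "digraph_iso H (hypercube k)"
      and maxH: "\<And>H' m. induced_subgraph H' ?G \<Longrightarrow> digraph_iso H' (hypercube m) \<Longrightarrow>
               subgraph H H' \<Longrightarrow> H = H'"
      unfolding maximal_hypercubes_def by blast+
    have eqC: "H = ?C S" if "S \<subseteq> {..<n}" "sparse p S" "subgraph H (?C S)" for S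
      using maxH[OF C_induced hypercube_iso_below] that by blast
    obtain S where S: "S \<subseteq> {..<n}" "sparse p S" "subgraph H (?C S)"
      using inside[OF H] by blast
    have HS: "H = ?C S" using eqC[OF S] .
    have "T = S" if T: "T \<subseteq> {..<n}" "sparse p T" "S \<subseteq> T" for T
    proof -
      have "subgraph H (?C T)"
        unfolding HS using wf_hypercube T
        by (intro subgraph_restrict_mono) (auto simp: below_def verts_hypercube)
      then have "?C S = ?C T" using eqC[OF T(1,2)] HS by simp
      then have "below n S = below n T" by (metis verts_C)
      then show ?thesis using below_mono_iff S(1) T(1) by (metis subset_antisym subset_refl)
    qed
    then have "max_sparse p n S" unfolding max_sparse_iff_maximal using S by blast
    moreover have "card S = k"
    proof -
      have "digraph_iso H (hypercube (card S))"
        unfolding HS by (rule hypercube_iso_below[OF S(1)])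
      then have "(2::nat) ^ card S = 2 ^ k"
        using card_verts_iso_hypercube[OF sub_hypercube[OF H(1)]] H(2) by metis
      then show ?thesis by simp
    qed
    ultimately show "H \<in> ?C ` {S. max_sparse p n S \<and> card S = k}" using HS by blast
  next
    fix H assume "H \<in> ?C ` {S. max_sparse p n S \<and> card S = k}"
    then obtain S where HS: "H = ?C S" and "max_sparse p n S" and k: "card S = k" by blast
    then have S: "S \<subseteq> {..<n}" "sparse p S"
      and maxS: "\<And>T. T \<subseteq> {..<n} \<Longrightarrow> sparse p T \<Longrightarrow> S \<subseteq> T \<Longrightarrow> T = S"
      unfolding max_sparse_iff_maximal by blast+
    have "H = H'" if H': "induced_subgraph H' ?G" "digraph_iso H' (hypercube m)" "subgraph H H'"
      for H' m
    proof -
      obtain T where T: "T \<subseteq> {..<n}" "sparse p T" "subgraph H' (?C T)"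
        using inside[OF H'(1,2)] by blast
      have "verts H \<subseteq> verts H'" "verts H' \<subseteq> below n T"
        using subgraph_imp_subverts[OF H'(3)] subgraph_imp_subverts[OF T(3)] by simp_all
      moreover from this have "T = S"
        using maxS[OF T(1,2)] below_mono_iff[OF S(1)] unfolding HS verts_C by blast
      ultimately have "verts H' = below n S" unfolding HS by auto
      then show ?thesis
        using H'(1) unfolding HS induced_subgraph_fibonacci_cube_iff by auto
    qed
    then show "H \<in> maximal_hypercubes ?G k"
      using C_induced[OF S(2)] hypercube_iso_below[OF S(1)] k
      unfolding maximal_hypercubes_def HS by blast
  qed
qed

theorem theorem7p2:
  fixes p k n :: nat
  assumes "p \<ge> 1" and "k \<le> n"
  shows "num_maximal_hypercubes (fibonacci_cube p n) k
       = pbinomial p (k + 1) (int n - (int p + 1) * int k + int p)"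
proof -
  have "inj_on (\<lambda>S. hypercube n \<restriction> below n S) {S. max_sparse p n S \<and> card S = k}"
  proof (rule inj_onI)
    fix S T assume ST: "S \<in> {S. max_sparse p n S \<and> card S = k}"
      "T \<in> {S. max_sparse p n S \<and> card S = k}" "hypercube n \<restriction> below n S = hypercube n \<restriction> below n T"
    then have "below n S = below n T" by (metis induce_subgraph_verts)
    moreover have "S \<subseteq> {..<n}" "T \<subseteq> {..<n}" using ST unfolding max_sparse_def by auto
    ultimately show "S = T" using below_mono_iff by (metis subset_antisym subset_refl)
  qed
  then show ?thesis
    unfolding num_maximal_hypercubes_def maximal_hypercubes_fibonacci_cube
    by (simp only: card_image card_max_sparse)
qed

end
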